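(* Let $M$ be an $n$-dimensional smooth submanifold of $\mathbb{R}^N$, let $p\in M$, and let $f:U\to\mathbb{R}^N$ ($U\subseteq\mathbb{R}^n$ open) be a smooth local parametrization of $M$ (a diffeomorphism onto an open subset of $M$) with $f(u_0)=p$. Then $f$ satisfies the local condition at $u_0$ if and only if both of the following hold: (1) the second fundamental form $\mathrm{I\!I}_p: T_pM\times T_pM\to (T_pM)^\perp$ is nonsingular as a bilinear map, i.e. $\mathrm{I\!I}_p(x,y)=0$ implies $x=0$ or $y=0$; (2) every regular smooth curve $\gamma:(0,1)\to M\subseteq\mathbb{R}^N$ with $\gamma(t_0)=p$ for some $t_0\in(0,1)$ satisfies $\gamma'''(t_0)\neq 0$. In particular, whether the local condition holds at $p$ does not depend on the choice of local parametrization.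
   Context: For a smooth $f:U\to\mathbb{R}^N$ and $a\in U$, $D^kf_a$ denotes the symmetric $k$-linear map of $k$-th order partial derivatives, $D^kf_a(e_{i_1},\dots,e_{i_k}) = \frac{\partial^k f}{\partial x_{i_1}\cdots\partial x_{i_k}}(a)$; $D^1f_a=Df_a$. The map $f$ satisfies the local condition at $a$ if every solution $(v_1,v_2,v_3,\lambda)\in\mathbb{R}^n\times\mathbb{R}^n\times\mathbb{R}^n\times\mathbb{R}$ of $Df_a(v_1)+D^2f_a(v_2,v_3)+\lambda D^3f_a(v_3,v_3,v_3)=0$ with $v_3\neq 0$ has $v_1=0$, $v_2=0$, $\lambda=0$. A curve is regular if its first derivative never vanishes. *)

theory Defs
  imports "HOL-Analysis.Analysis"
begin

(* Iterated directional (Frechet) derivatives: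
   hderiv f [v1,...,vk] a = D^k f_a(v1,...,vk). *)
fun hderiv :: "('a::real_normed_vector \<Rightarrow> 'b::real_normed_vector) \<Rightarrow> 'a list \<Rightarrow> 'a \<Rightarrow> 'b" where
  "hderiv f [] = f"
| "hderiv f (v # vs) = (\<lambda>x. frechet_derivative (hderiv f vs) (at x) v)"

definition smooth_on :: "'a::real_normed_vector set \<Rightarrow> ('a \<Rightarrow> 'b::real_normed_vector) \<Rightarrow> bool" where
  "smooth_on U f \<longleftrightarrow> (\<forall>vs. \<forall>x\<in>U. hderiv f vs differentiable (at x))"

definition local_condition :: "('a::euclidean_space \<Rightarrow> 'b::euclidean_space) \<Rightarrow> 'a \<Rightarrow> bool" where
  "local_condition f a \<longleftrightarrow>
     (\<forall>v1 v2 v3 (c::real).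
        v3 \<noteq> 0 \<and> hderiv f [v1] a + hderiv f [v2, v3] a + c *\<^sub>R hderiv f [v3, v3, v3] a = 0
        \<longrightarrow> v1 = 0 \<and> v2 = 0 \<and> c = 0)"

(* smooth local parametrization of M: smooth immersion of an open U which is a homeomorphism
   onto an open subset of M (equivalently a diffeomorphism onto an open subset of M) *)
definition local_param :: "'b::euclidean_space set \<Rightarrow> 'a::euclidean_space set \<Rightarrow> ('a \<Rightarrow> 'b) \<Rightarrow> bool" where
  "local_param M U f \<longleftrightarrow>
     open U \<and> smooth_on U f \<and> f ` U \<subseteq> M \<and> openin (top_of_set M) (f ` U) \<and>
     inj_on f U \<and> continuous_on (f ` U) (inv_into U f) \<and>
     (\<forall>u\<in>U. inj (frechet_derivative f (at u)))"

(* M is an n-dimensional smooth submanifold of R^N, with n = DIM('a), N = DIM('b) *)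
definition smooth_submanifold :: "'b::euclidean_space set \<Rightarrow> 'a::euclidean_space itself \<Rightarrow> bool" where
  "smooth_submanifold M _ \<longleftrightarrow>
     (\<forall>p\<in>M. \<exists>U (f::'a \<Rightarrow> 'b). local_param M U f \<and> p \<in> f ` U)"

definition chart_at :: "'b::euclidean_space set \<Rightarrow> 'a::euclidean_space itself \<Rightarrow> 'b \<Rightarrow> ('a \<Rightarrow> 'b) \<times> 'a" where
  "chart_at M _ p = (SOME (f, u). \<exists>U. local_param M U f \<and> u \<in> U \<and> f u = p)"

definition tangent_space :: "'b::euclidean_space set \<Rightarrow> 'a::euclidean_space itself \<Rightarrow> 'b \<Rightarrow> 'b set" where
  "tangent_space M A p =
     (case chart_at M A p of (f, u) \<Rightarrow> range (frechet_derivative f (at u)))"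

definition normal_proj :: "'b::euclidean_space set \<Rightarrow> 'b \<Rightarrow> 'b" where
  "normal_proj T v = (THE w. (\<forall>t\<in>T. w \<bullet> t = 0) \<and> v - w \<in> T)"

definition second_fundamental_form ::
  "'b::euclidean_space set \<Rightarrow> 'a::euclidean_space itself \<Rightarrow> 'b \<Rightarrow> 'b \<Rightarrow> 'b \<Rightarrow> 'b" where
  "second_fundamental_form M A p x y =
     (case chart_at M A p of (f, u) \<Rightarrow>
        (let a = (SOME a. frechet_derivative f (at u) a = x);
             b = (SOME b. frechet_derivative f (at u) b = y)
         in normal_proj (tangent_space M A p) (hderiv f [a, b] u)))"

end

theory Submission
  imports Defs
begin

text \<open>
  Charts are compared through curves only. Any smooth curve \<open>\<gamma>\<close> in \<open>M\<close> through \<open>p\<close> lifts, near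
  its base point, to \<open>\<gamma> = g \<circ> c\<close> for a given chart \<open>g\<close>, and then
  \<open>\<gamma>''' = D\<^sup>3g(c',c',c') + 3 D\<^sup>2g(c'',c') + Dg(c''')\<close>. Conversely, composing \<open>g\<close> with cubic
  polynomials realises every triple \<open>(c',c'',c''')\<close> with \<open>c' \<noteq> 0\<close>. So solutions of the equation in
  the local condition with nonzero \<open>\<lambda>\<close> correspond to regular curves with \<open>\<gamma>''' = 0\<close>, while
  solutions with \<open>\<lambda> = 0\<close> are pairs with \<open>D\<^sup>2g(v\<^sub>2,v\<^sub>3)\<close> tangent, that is, zeros of the second
  fundamental form. The latter is taken in the fixed chart of \<open>chart_at\<close>; comparing velocities and
  accelerations of curves shows that the tangent space and the quadratic form
  \<open>x \<mapsto> II(x,x)\<close> do not depend on the chart, and polarization gives the same for \<open>II\<close>.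
\<close>

section \<open>Iterated derivatives\<close>

lemma hderiv_has_derivative:
  assumes "smooth_on U f" "x \<in> U"
  shows "(hderiv f vs has_derivative (\<lambda>v. hderiv f (v # vs) x)) (at x)"
proof -
  have "(hderiv f vs has_derivative frechet_derivative (hderiv f vs) (at x)) (at x)"
    using assms unfolding smooth_on_def frechet_derivative_works by blast
  then show ?thesis by simp
qed

text \<open>The outermost slot is linear because a Frechet derivative is. For a deeper slot, the
  induction hypothesis holds at all points of the open set \<open>U\<close>, so the functions being
  differentiated agree near \<open>x\<close>, and uniqueness of the derivative passes additivity and
  homogeneity through one more differentiation.\<close>

lemma linear_hderiv:
  assumes "open U" "smooth_on U f" "x \<in> U"
  shows "linear (\<lambda>v. hderiv f (us @ v # vs) x)"
  using assms(3)
proof (induction us arbitrary: x)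
  case Nil
  have "bounded_linear (\<lambda>v. hderiv f (v # vs) x)"
    using hderiv_has_derivative[OF assms(2) Nil] by (rule has_derivative_bounded_linear)
  then show ?case by (simp add: bounded_linear.linear)
next
  case (Cons u us)
  let ?h = "\<lambda>v. hderiv f (us @ v # vs)"
  have d: "(?h v has_derivative (\<lambda>u. hderiv f (u # us @ v # vs) x)) (at x)" for v
    by (rule hderiv_has_derivative[OF assms(2) Cons.prems])
  show ?case
  proof (rule linearI)
    fix a b
    have "(?h (a + b) has_derivative
        (\<lambda>u. hderiv f (u # us @ a # vs) x + hderiv f (u # us @ b # vs) x)) (at x)"
      by (rule has_derivative_transform_within_open[OF has_derivative_add[OF d[of a] d[of b]] assms(1) Cons.prems])
         (simp add: linear_add[OF Cons.IH])
    from has_derivative_unique[OF d this] show "hderiv f ((u # us) @ (a + b) # vs) x =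
        hderiv f ((u # us) @ a # vs) x + hderiv f ((u # us) @ b # vs) x"
      by (metis append_Cons)
  next
    fix r b
    have "(?h (r *\<^sub>R b) has_derivative (\<lambda>u. r *\<^sub>R hderiv f (u # us @ b # vs) x)) (at x)"
      by (rule has_derivative_transform_within_open[OF has_derivative_scaleR_right[OF d[of b]] assms(1) Cons.prems])
         (simp add: linear_cmul[OF Cons.IH])
    from has_derivative_unique[OF d this]
    show "hderiv f ((u # us) @ (r *\<^sub>R b) # vs) x = r *\<^sub>R hderiv f ((u # us) @ b # vs) x"
      by (metis append_Cons)
  qed
qed

lemma hderiv_line_has_real_derivative:
  fixes f :: "'a::real_normed_vector \<Rightarrow> 'b::euclidean_space"
  assumes "smooth_on U f" "x + s *\<^sub>R v \<in> U"
  shows "((\<lambda>s. hderiv f vs (x + s *\<^sub>R v) \<bullet> e) has_real_derivative hderiv f (v # vs) (x + s *\<^sub>R v) \<bullet> e) (at s)"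
proof -
  have "((\<lambda>s. x + s *\<^sub>R v) has_derivative (\<lambda>r. r *\<^sub>R v)) (at s)"
    by (auto intro!: derivative_eq_intros)
  from has_derivative_compose[OF this hderiv_has_derivative[OF assms]]
  have "((\<lambda>s. hderiv f vs (x + s *\<^sub>R v) \<bullet> e) has_derivative
      (\<lambda>r. hderiv f ((r *\<^sub>R v) # vs) (x + s *\<^sub>R v) \<bullet> e)) (at s)"
    by (rule has_derivative_inner_left)
  moreover have "hderiv f ((r *\<^sub>R v) # vs) (x + s *\<^sub>R v) = r *\<^sub>R hderiv f (v # vs) (x + s *\<^sub>R v)" for r
    using linear_cmul[OF bounded_linear.linear[OF has_derivative_bounded_linear[OF hderiv_has_derivative[OF assms]]]] .
  ultimately show ?thesis
    by (simp add: has_real_derivative_iff_has_vector_derivative has_vector_derivative_def)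
qed

section \<open>Symmetry of second derivatives\<close>

text \<open>Two applications of the mean value theorem write the second difference as
  \<open>h\<^sup>2\<close> times the mixed derivative at a point of the parallelogram, and that
  derivative is continuous at \<open>x\<close>. Pairing with \<open>e\<close> makes the functions
  real valued, as the mean value theorem demands.\<close>

lemma second_difference_tendsto:
  fixes f :: "'a::real_normed_vector \<Rightarrow> 'b::euclidean_space"
  assumes "open U" "smooth_on U f" "x \<in> U"
  shows "((\<lambda>h. ((f (x + h *\<^sub>R v + h *\<^sub>R w) - f (x + h *\<^sub>R v) - f (x + h *\<^sub>R w) + f x) \<bullet> e) / h\<^sup>2)
           \<longlongrightarrow> hderiv f [w, v] x \<bullet> e) (at_right 0)"
proof (rule tendstoI)
  fix r :: real assume "r > 0"
  have "isCont (\<lambda>y. hderiv f [w, v] y \<bullet> e) x"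
    using has_derivative_continuous[OF hderiv_has_derivative[OF assms(2,3)]]
    by (intro continuous_intros)
  then obtain d1 where d1: "d1 > 0"
      "\<And>y. dist y x < d1 \<Longrightarrow> dist (hderiv f [w, v] y \<bullet> e) (hderiv f [w, v] x \<bullet> e) < r"
    using \<open>r > 0\<close> unfolding continuous_at_eps_delta dist_real_def dist_norm by (metis real_norm_def)
  obtain d2 where d2: "d2 > 0" "ball x d2 \<subseteq> U"
    using assms(1,3) open_contains_ball by blast
  \<comment> \<open>For \<open>h < d\<close> the whole parallelogram lies within
    \<open>min d1 d2\<close> of \<open>x\<close>; the summand 1 keeps the denominator positive when
    \<open>v\<close> and \<open>w\<close> vanish.\<close>
  define d where "d = min d1 d2 / (norm v + norm w + 1)"
  have np: "norm v + norm w + 1 > 0"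
    by (simp add: add_nonneg_pos)
  have "d > 0" using d1(1) d2(1) np by (simp add: d_def)
  have near: "dist (x + s *\<^sub>R v + t *\<^sub>R w) x < min d1 d2"
    if "0 \<le> s" "s \<le> h" "0 \<le> t" "t \<le> h" "h < d" for s t h
  proof -
    have "dist (x + s *\<^sub>R v + t *\<^sub>R w) x = norm (s *\<^sub>R v + t *\<^sub>R w)"
      by (simp add: dist_norm add.assoc)
    also have "\<dots> \<le> s * norm v + t * norm w"
      using norm_triangle_ineq[of "s *\<^sub>R v" "t *\<^sub>R w"] that by simp
    also have "\<dots> \<le> h * norm v + h * norm w"
      using that by (intro add_mono mult_right_mono) auto
    also have "\<dots> \<le> h * (norm v + norm w + 1)"
      using that by (simp add: algebra_simps)
    also have "\<dots> < d * (norm v + norm w + 1)"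
      using that np by simp
    also have "\<dots> = min d1 d2"
      unfolding d_def using np by simp
    finally show ?thesis .
  qed
  have inU: "x + s *\<^sub>R v + t *\<^sub>R w \<in> U" if "0 \<le> s" "s \<le> h" "0 \<le> t" "t \<le> h" "h < d" for s t h
    using near[OF that] d2(2) by (auto simp: dist_commute)
  have "dist (((f (x + h *\<^sub>R v + h *\<^sub>R w) - f (x + h *\<^sub>R v) - f (x + h *\<^sub>R w) + f x) \<bullet> e) / h\<^sup>2)
      (hderiv f [w, v] x \<bullet> e) < r" if h: "0 < h" "h < d" for h
  proof -
    \<comment> \<open>The increment in direction \<open>w\<close>, as a function of the position
      along \<open>v\<close>. The mean value theorem for \<open>\<psi>\<close> gives
      \<open>s\<close>, and then along \<open>w\<close> it gives \<open>t\<close>; each contributes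
      a factor \<open>h\<close>.\<close>
    define \<psi> where "\<psi> s = f (x + s *\<^sub>R v + h *\<^sub>R w) \<bullet> e - f (x + s *\<^sub>R v) \<bullet> e" for s
    have "(\<psi> has_real_derivative hderiv f [v] (x + s *\<^sub>R v + h *\<^sub>R w) \<bullet> e - hderiv f [v] (x + s *\<^sub>R v) \<bullet> e) (at s)"
      if "0 \<le> s" "s \<le> h" for s
    proof -
      have "((\<lambda>s. f (x + s *\<^sub>R v) \<bullet> e) has_real_derivative hderiv f [v] (x + s *\<^sub>R v) \<bullet> e) (at s)"
        using hderiv_line_has_real_derivative[OF assms(2), of x s v "[]" e] inU[of s h 0] that h by simp
      moreover have "((\<lambda>s. f (x + s *\<^sub>R v + h *\<^sub>R w) \<bullet> e) has_real_derivative
          hderiv f [v] (x + s *\<^sub>R v + h *\<^sub>R w) \<bullet> e) (at s)"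
        using hderiv_line_has_real_derivative[OF assms(2), of "x + h *\<^sub>R w" s v "[]" e] inU[of s h h] that h
        by (simp add: ac_simps)
      ultimately show ?thesis
        unfolding \<psi>_def[abs_def] by (rule DERIV_diff[rotated])
    qed
    from MVT2[OF h(1) this] obtain s where s: "0 < s" "s < h"
      "\<psi> h - \<psi> 0 = h * (hderiv f [v] (x + s *\<^sub>R v + h *\<^sub>R w) \<bullet> e - hderiv f [v] (x + s *\<^sub>R v) \<bullet> e)"
      by auto
    have "((\<lambda>t. hderiv f [v] (x + s *\<^sub>R v + t *\<^sub>R w) \<bullet> e) has_real_derivative
          hderiv f [w, v] (x + s *\<^sub>R v + t *\<^sub>R w) \<bullet> e) (at t)" if "0 \<le> t" "t \<le> h" for t
      using hderiv_line_has_real_derivative[OF assms(2), of "x + s *\<^sub>R v" t w "[v]" e] inU[of s h t] that h s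
      by simp
    from MVT2[OF h(1) this] obtain t where t: "0 < t" "t < h"
      "hderiv f [v] (x + s *\<^sub>R v + h *\<^sub>R w) \<bullet> e - hderiv f [v] (x + s *\<^sub>R v) \<bullet> e
         = h * (hderiv f [w, v] (x + s *\<^sub>R v + t *\<^sub>R w) \<bullet> e)"
      by auto
    have "((f (x + h *\<^sub>R v + h *\<^sub>R w) - f (x + h *\<^sub>R v) - f (x + h *\<^sub>R w) + f x) \<bullet> e) = \<psi> h - \<psi> 0"
      unfolding \<psi>_def by (simp add: inner_simps)
    also have "\<dots> = h\<^sup>2 * (hderiv f [w, v] (x + s *\<^sub>R v + t *\<^sub>R w) \<bullet> e)"
      unfolding s(3) t(3) by (simp only: power2_eq_square mult.assoc)
    finally have "((f (x + h *\<^sub>R v + h *\<^sub>R w) - f (x + h *\<^sub>R v) - f (x + h *\<^sub>R w) + f x) \<bullet> e) / h\<^sup>2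
        = hderiv f [w, v] (x + s *\<^sub>R v + t *\<^sub>R w) \<bullet> e"
      using h(1) by simp
    then show ?thesis
      using d1(2) near[of s h t] s t h by (simp del: hderiv.simps)
  qed
  then show "\<forall>\<^sub>F h in at_right 0. dist (((f (x + h *\<^sub>R v + h *\<^sub>R w) - f (x + h *\<^sub>R v) - f (x + h *\<^sub>R w) + f x) \<bullet> e) / h\<^sup>2)
      (hderiv f [w, v] x \<bullet> e) < r"
    unfolding eventually_at_right_field using \<open>d > 0\<close> by blast
qed

text \<open>The second difference is symmetric in \<open>v\<close> and \<open>w\<close>, so both
  mixed derivatives are limits of the same quotient.\<close>

lemma hderiv_commute:
  fixes f :: "'a::real_normed_vector \<Rightarrow> 'b::euclidean_space"
  assumes "open U" "smooth_on U f" "x \<in> U"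
  shows "hderiv f [v, w] x = hderiv f [w, v] x"
proof (rule euclidean_eqI)
  fix e :: 'b
  show "hderiv f [v, w] x \<bullet> e = hderiv f [w, v] x \<bullet> e"
  proof (rule tendsto_unique[OF trivial_limit_at_right_real second_difference_tendsto[OF assms]])
    show "((\<lambda>h. ((f (x + h *\<^sub>R w + h *\<^sub>R v) - f (x + h *\<^sub>R w) - f (x + h *\<^sub>R v) + f x) \<bullet> e) / h\<^sup>2)
           \<longlongrightarrow> hderiv f [w, v] x \<bullet> e) (at_right 0)"
      using second_difference_tendsto[OF assms, of v w e] by (simp add: algebra_simps del: hderiv.simps)
  qed
qed

section \<open>Lifting derivatives through injective linear maps\<close>

lemma has_vector_derivative_iff_tendsto:
  "(f has_vector_derivative f') (at t) \<longleftrightarrow> ((\<lambda>s. (f s - f t) /\<^sub>R (s - t)) \<longlongrightarrow> f') (at t)"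
proof -
  have *: "norm (f s - f t - (s - t) *\<^sub>R f') / norm (s - t) = norm ((f s - f t) /\<^sub>R (s - t) - f')"
    if "s \<noteq> t" for s
  proof -
    have "(f s - f t) /\<^sub>R (s - t) - f' = (f s - f t - (s - t) *\<^sub>R f') /\<^sub>R (s - t)"
      using that by (simp add: scaleR_diff_right)
    then show ?thesis by (simp add: divide_inverse mult.commute)
  qed
  have "(f has_vector_derivative f') (at t) \<longleftrightarrow>
      ((\<lambda>s. norm (f s - f t - (s - t) *\<^sub>R f') / norm (s - t)) \<longlongrightarrow> 0) (at t)"
    by (simp only: has_vector_derivative_def has_derivative_iff_norm bounded_linear_scaleR_left simp_thms)
  also have "\<dots> \<longleftrightarrow> ((\<lambda>s. norm ((f s - f t) /\<^sub>R (s - t) - f')) \<longlongrightarrow> 0) (at t)"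
    by (rule tendsto_cong) (rule eventually_mono[OF eventually_neq_at_within], rule *)
  also have "\<dots> \<longleftrightarrow> ((\<lambda>s. (f s - f t) /\<^sub>R (s - t)) \<longlongrightarrow> f') (at t)"
    by (simp only: tendsto_norm_zero_iff LIM_zero_iff)
  finally show ?thesis .
qed

text \<open>An injective \<open>L\<close> is bounded below by some \<open>k > 0\<close>. Once
  \<open>e t < k / 2\<close>, the error is absorbed and \<open>norm (q t)\<close> is at most a
  constant times \<open>norm (R t)\<close>; hence \<open>R - L q\<close> tends to 0, and a linear
  left inverse of \<open>L\<close> recovers the limit of \<open>q\<close>. Below, \<open>q\<close>
  is a difference quotient whose convergence is to be shown.\<close>

lemma perturbed_linear_solution_tendsto:
  fixes L :: "'a::euclidean_space \<Rightarrow> 'b::euclidean_space"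
  assumes "linear L" "inj L" "F \<noteq> bot"
    and R: "(R \<longlongrightarrow> w) F" and e: "(e \<longlongrightarrow> (0::real)) F"
    and le: "\<forall>\<^sub>F t in F. norm (R t - L (q t)) \<le> e t * norm (q t)"
  obtains l where "(q \<longlongrightarrow> l) F" "L l = w"
proof -
  obtain k where k: "k > 0" "\<And>x. k * norm x \<le> norm (L x)"
    using linear_inj_bounded_below_pos[OF assms(1,2)] by blast
  have "\<forall>\<^sub>F t in F. e t < k / 2"
    using order_tendstoD(2)[OF e, of "k / 2"] k(1) by simp
  then have bound: "\<forall>\<^sub>F t in F. norm (R t - L (q t)) \<le> \<bar>e t\<bar> * (2 / k * norm (R t))"
    using le
  proof eventually_elim
    case (elim t)
    have "k * norm (q t) \<le> norm (L (q t))" by (rule k(2))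
    also have "\<dots> \<le> norm (R t) + norm (R t - L (q t))"
      by norm
    also have "\<dots> \<le> norm (R t) + k / 2 * norm (q t)"
      using elim mult_right_mono[of "e t" "k / 2" "norm (q t)"] by simp
    finally have "norm (q t) \<le> 2 / k * norm (R t)"
      using k(1) by (simp add: field_simps)
    then have "\<bar>e t\<bar> * norm (q t) \<le> \<bar>e t\<bar> * (2 / k * norm (R t))"
      by (intro mult_left_mono) auto
    moreover have "e t * norm (q t) \<le> \<bar>e t\<bar> * norm (q t)"
      by (intro mult_right_mono) auto
    ultimately show ?case using elim by linarith
  qed
  have "((\<lambda>t. \<bar>e t\<bar> * (2 / k * norm (R t))) \<longlongrightarrow> \<bar>0\<bar> * (2 / k * norm w)) F"
    by (intro tendsto_intros e R)
  then have "((\<lambda>t. R t - L (q t)) \<longlongrightarrow> 0) F"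
    using Lim_null_comparison[OF bound] by simp
  from tendsto_diff[OF R this] have Lq: "((\<lambda>t. L (q t)) \<longlongrightarrow> w) F"
    by simp
  obtain B where B: "linear B" "B \<circ> L = id"
    using linear_injective_left_inverse[OF assms(1,2)] by blast
  have "((\<lambda>t. B (L (q t))) \<longlongrightarrow> B w) F"
    using linear_conv_bounded_linear[of B] B(1) Lq bounded_linear.tendsto by blast
  then have q: "(q \<longlongrightarrow> B w) F"
    using B(2) by (simp add: fun_eq_iff)
  then have "((\<lambda>t. L (q t)) \<longlongrightarrow> L (B w)) F"
    using linear_conv_bounded_linear[of L] assms(1) bounded_linear.tendsto by blast
  from tendsto_unique[OF assms(3) this Lq] q that show thesis by blast
qed

text \<open>A converse of the chain rule: the difference quotient of \<open>c\<close> solves, up to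
  a relative error tending to 0, the linear equation with matrix \<open>g'\<close> whose right-hand
  side is the difference quotient of \<open>g \<circ> c\<close>.\<close>

lemma has_vector_derivative_lift:
  fixes g :: "'a::euclidean_space \<Rightarrow> 'b::euclidean_space" and c :: "real \<Rightarrow> 'a"
  assumes g: "(g has_derivative g') (at (c t))" and "inj g'" and c: "isCont c t"
    and gc: "((\<lambda>s. g (c s)) has_vector_derivative w) (at t)"
  obtains c' where "(c has_vector_derivative c') (at t)"
proof -
  \<comment> \<open>The relative remainder of \<open>g\<close>. Division by zero gives it the value
    0 at \<open>c t\<close>, so it is continuous there and may be composed with \<open>c\<close>
    even if \<open>c\<close> returns to \<open>c t\<close>.\<close>
  define \<rho> where "\<rho> y = norm (g y - g (c t) - g' (y - c t)) / norm (y - c t)" for y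
  have "(\<rho> \<longlongrightarrow> 0) (at (c t))"
    using g unfolding has_derivative_iff_norm \<rho>_def by blast
  then have "isCont \<rho> (c t)"
    unfolding isCont_def by (simp add: \<rho>_def)
  with c have "isCont (\<lambda>s. \<rho> (c s)) t"
    by (rule isCont_o2)
  then have e: "((\<lambda>s. \<rho> (c s)) \<longlongrightarrow> 0) (at t)"
    unfolding isCont_def by (simp add: \<rho>_def)
  have lin: "linear g'"
    using g by (simp add: has_derivative_bounded_linear bounded_linear.linear)
  have "norm ((g (c s) - g (c t)) /\<^sub>R (s - t) - g' ((c s - c t) /\<^sub>R (s - t)))
      \<le> \<rho> (c s) * norm ((c s - c t) /\<^sub>R (s - t))" for s
  proof -
    have "(g (c s) - g (c t)) /\<^sub>R (s - t) - g' ((c s - c t) /\<^sub>R (s - t)) =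
        (g (c s) - g (c t) - g' (c s - c t)) /\<^sub>R (s - t)"
      by (simp add: linear_diff[OF lin] linear_cmul[OF lin] scaleR_diff_right)
    moreover have "norm (g (c s) - g (c t) - g' (c s - c t)) = \<rho> (c s) * norm (c s - c t)"
      using linear_0[OF lin] by (simp add: \<rho>_def)
    ultimately show ?thesis by simp
  qed
  then have "\<forall>\<^sub>F s in at t. norm ((g (c s) - g (c t)) /\<^sub>R (s - t) - g' ((c s - c t) /\<^sub>R (s - t)))
      \<le> \<rho> (c s) * norm ((c s - c t) /\<^sub>R (s - t))"
    by (intro always_eventually allI)
  from perturbed_linear_solution_tendsto[OF lin \<open>inj g'\<close> _ gc[unfolded has_vector_derivative_iff_tendsto] e this]
  obtain l where "((\<lambda>s. (c s - c t) /\<^sub>R (s - t)) \<longlongrightarrow> l) (at t)"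
    by auto
  then show thesis
    using that has_vector_derivative_iff_tendsto by blast
qed

lemma linear_Basis_expansion:
  fixes A :: "'a::euclidean_space \<Rightarrow> 'b::real_vector"
  assumes "linear A"
  shows "A v = (\<Sum>b\<in>Basis. (v \<bullet> b) *\<^sub>R A b)"
proof -
  have "A (\<Sum>b\<in>Basis. (v \<bullet> b) *\<^sub>R b) = (\<Sum>b\<in>Basis. (v \<bullet> b) *\<^sub>R A b)"
    by (simp only: linear_sum[OF assms] linear_cmul[OF assms])
  then show ?thesis by (simp only: euclidean_representation)
qed

lemma norm_linear_le_Basis_sum:
  fixes A :: "'a::euclidean_space \<Rightarrow> 'b::real_normed_vector"
  assumes "linear A"
  shows "norm (A v) \<le> (\<Sum>b\<in>Basis. norm (A b)) * norm v"
proof -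
  have "norm (A v) \<le> (\<Sum>b\<in>Basis. norm ((v \<bullet> b) *\<^sub>R A b))"
    unfolding linear_Basis_expansion[OF assms, of v] by (rule norm_sum)
  also have "\<dots> = (\<Sum>b\<in>Basis. \<bar>v \<bullet> b\<bar> * norm (A b))"
    by simp
  also have "\<dots> \<le> (\<Sum>b\<in>Basis. norm v * norm (A b))"
    by (intro sum_mono mult_right_mono) (auto simp: Basis_le_norm)
  finally show ?thesis by (simp add: sum_distrib_left mult.commute)
qed

text \<open>Expanding \<open>y s\<close> in the basis reduces the claim to the product rule for
  finitely many terms, so it suffices to differentiate \<open>L s v\<close> for each fixed
  \<open>v\<close>.\<close>

lemma has_vector_derivative_linear_apply:
  fixes L :: "real \<Rightarrow> 'a::euclidean_space \<Rightarrow> 'b::real_normed_vector"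
  assumes "open J" "t \<in> J" and lin: "\<And>s. s \<in> J \<Longrightarrow> linear (L s)" and lin': "linear L'"
    and L: "\<And>v. ((\<lambda>s. L s v) has_vector_derivative L' v) (at t)"
    and y: "(y has_vector_derivative y') (at t)"
  shows "((\<lambda>s. L s (y s)) has_vector_derivative L' (y t) + L t y') (at t)"
proof -
  have yb: "((\<lambda>s. y s \<bullet> b) has_real_derivative y' \<bullet> b) (at t)" for b
    using bounded_linear.has_vector_derivative[OF bounded_linear_inner_left y]
    by (simp add: has_real_derivative_iff_has_vector_derivative)
  have "((\<lambda>s. \<Sum>b\<in>Basis. (y s \<bullet> b) *\<^sub>R L s b) has_vector_derivative
      (\<Sum>b\<in>Basis. (y t \<bullet> b) *\<^sub>R L' b + (y' \<bullet> b) *\<^sub>R L t b)) (at t)"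
    by (intro has_vector_derivative_sum has_vector_derivative_scaleR yb L)
  moreover have "(\<Sum>b\<in>Basis. (y t \<bullet> b) *\<^sub>R L' b + (y' \<bullet> b) *\<^sub>R L t b) = L' (y t) + L t y'"
    using linear_Basis_expansion[OF lin', of "y t"] linear_Basis_expansion[OF lin[OF assms(2)], of y'] by (simp add: sum.distrib)
  ultimately have "((\<lambda>s. \<Sum>b\<in>Basis. (y s \<bullet> b) *\<^sub>R L s b) has_vector_derivative L' (y t) + L t y') (at t)"
    by simp
  then show ?thesis
    by (rule has_vector_derivative_transform_within_open[OF _ assms(1,2)])
       (rule linear_Basis_expansion[OF lin, symmetric])
qed

text \<open>Freezing the coefficient at \<open>L t\<close> costs an error of at most
  \<open>e s\<close> times the norm of the difference quotient of \<open>y\<close>. Finite dimension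
  makes \<open>e\<close> tend to 0, although \<open>L\<close> converges only pointwise by
  assumption.\<close>

lemma has_vector_derivative_linear_solution:
  fixes L :: "real \<Rightarrow> 'a::euclidean_space \<Rightarrow> 'b::euclidean_space"
  assumes "open J" "t \<in> J" and lin: "\<And>s. s \<in> J \<Longrightarrow> linear (L s)" and "inj (L t)"
    and L: "\<And>v. ((\<lambda>s. L s v) has_vector_derivative L' v) (at t)"
    and z: "((\<lambda>s. L s (y s)) has_vector_derivative z') (at t)"
  obtains y' where "(y has_vector_derivative y') (at t)"
proof -
  define e where "e s = (\<Sum>b\<in>Basis. norm (L s b - L t b))" for s
  \<comment> \<open>The difference quotient of \<open>L s (y s)\<close> without the part caused by
    the variation of \<open>L\<close> at the fixed vector \<open>y t\<close>. What remains is
    exactly \<open>L s\<close> applied to the difference quotient of \<open>y\<close>.\<close>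
  define R where "R s = (L s (y s) - L t (y t)) /\<^sub>R (s - t) - (L s (y t) - L t (y t)) /\<^sub>R (s - t)" for s
  have lt: "linear (L t)" by (rule lin[OF assms(2)])
  have "((\<lambda>s. L s v) \<longlongrightarrow> L t v) (at t)" for v
    using has_vector_derivative_continuous[OF L[of v]] by (simp add: isCont_def)
  then have "(e \<longlongrightarrow> (\<Sum>b\<in>(Basis::'a set). norm (L t b - L t b))) (at t)"
    unfolding e_def by (intro tendsto_intros)
  then have e: "(e \<longlongrightarrow> 0) (at t)" by simp
  have R: "(R \<longlongrightarrow> z' - L' (y t)) (at t)"
    unfolding R_def using z L[of "y t"] unfolding has_vector_derivative_iff_tendsto by (intro tendsto_diff)
  have le: "norm (R s - L t ((y s - y t) /\<^sub>R (s - t))) \<le> e s * norm ((y s - y t) /\<^sub>R (s - t))" if "s \<in> J" for s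
  proof -
    let ?q = "(y s - y t) /\<^sub>R (s - t)"
    have "R s = L s ?q"
      by (simp add: R_def linear_diff[OF lin[OF that]] linear_cmul[OF lin[OF that]] scaleR_diff_right)
    moreover have "norm (L s ?q - L t ?q) \<le> e s * norm ?q"
      unfolding e_def by (rule norm_linear_le_Basis_sum) (intro linear_compose_sub lin that lt)
    ultimately show ?thesis by simp
  qed
  have "\<forall>\<^sub>F s in at t. s \<in> J"
    using assms(1,2) eventually_at_topological by blast
  then have "\<forall>\<^sub>F s in at t. norm (R s - L t ((y s - y t) /\<^sub>R (s - t))) \<le> e s * norm ((y s - y t) /\<^sub>R (s - t))"
    by (rule eventually_mono) (rule le)
  from perturbed_linear_solution_tendsto[OF lt assms(4) _ R e this]
  obtain l where "((\<lambda>s. (y s - y t) /\<^sub>R (s - t)) \<longlongrightarrow> l) (at t)" by auto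
  then show thesis
    using that has_vector_derivative_iff_tendsto by blast
qed

section \<open>Jets of curves\<close>

declare hderiv.simps(2) [simp del]

lemma hderiv_has_vector_derivative_along:
  assumes "smooth_on U g" "(c has_vector_derivative c') (at t)" "c t \<in> U"
  shows "((\<lambda>s. hderiv g vs (c s)) has_vector_derivative hderiv g (c' # vs) (c t)) (at t)"
proof -
  have d: "(hderiv g vs has_derivative (\<lambda>v. hderiv g (v # vs) (c t))) (at (c t))"
    by (rule hderiv_has_derivative[OF assms(1,3)])
  have "((\<lambda>s. hderiv g vs (c s)) has_derivative (\<lambda>r. hderiv g ((r *\<^sub>R c') # vs) (c t))) (at t)"
    by (rule has_derivative_compose[OF assms(2)[unfolded has_vector_derivative_def] d])
  then show ?thesis
    unfolding has_vector_derivative_def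
    by (simp add: linear_cmul[OF bounded_linear.linear[OF has_derivative_bounded_linear[OF d]]])
qed

lemma smooth_curve_has_vector_derivative:
  assumes "smooth_on I \<gamma>" "t \<in> I"
  shows "(hderiv \<gamma> vs has_vector_derivative hderiv \<gamma> (1 # vs) t) (at t)"
  using hderiv_has_vector_derivative_along[OF assms(1) has_vector_derivative_id assms(2)] by simp

context
  fixes g :: "'a::euclidean_space \<Rightarrow> 'b::euclidean_space" and V J c c1
  assumes V: "open V" and g: "smooth_on V g" and J: "open J"
    and c: "\<And>t. t \<in> J \<Longrightarrow> c t \<in> V" "\<And>t. t \<in> J \<Longrightarrow> (c has_vector_derivative c1 t) (at t)"
begin

lemma hderiv1_along_has_vector_derivative:
  assumes "t \<in> J" "(y has_vector_derivative y') (at t)"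
  shows "((\<lambda>s. hderiv g (y s # vs) (c s)) has_vector_derivative
           hderiv g (c1 t # y t # vs) (c t) + hderiv g (y' # vs) (c t)) (at t)"
proof (rule has_vector_derivative_linear_apply[OF J assms(1) _ _ _ assms(2)])
  show "linear (\<lambda>v. hderiv g (v # vs) (c s))" if "s \<in> J" for s
    using linear_hderiv[OF V g c(1)[OF that], of "[]" vs] by simp
  show "linear (\<lambda>v. hderiv g (c1 t # v # vs) (c t))"
    using linear_hderiv[OF V g c(1)[OF assms(1)], of "[c1 t]" vs] by simp
  show "((\<lambda>s. hderiv g (v # vs) (c s)) has_vector_derivative hderiv g (c1 t # v # vs) (c t)) (at t)" for v
    by (rule hderiv_has_vector_derivative_along[OF g c(2)[OF assms(1)] c(1)[OF assms(1)]])
qed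

lemma hderiv2_along_has_vector_derivative:
  assumes "t \<in> J" "(y has_vector_derivative y') (at t)" "(z has_vector_derivative z') (at t)"
  shows "((\<lambda>s. hderiv g [y s, z s] (c s)) has_vector_derivative
           hderiv g [c1 t, y t, z t] (c t) + hderiv g [y', z t] (c t) + hderiv g [y t, z'] (c t)) (at t)"
proof (rule has_vector_derivative_linear_apply[OF J assms(1) _ _ _ assms(3)])
  show "linear (\<lambda>v. hderiv g [y s, v] (c s))" if "s \<in> J" for s
    using linear_hderiv[OF V g c(1)[OF that], of "[y s]" "[]"] by simp
  show "linear (\<lambda>v. hderiv g [c1 t, y t, v] (c t) + hderiv g [y', v] (c t))"
    using linear_hderiv[OF V g c(1)[OF assms(1)], of "[c1 t, y t]" "[]"]
      linear_hderiv[OF V g c(1)[OF assms(1)], of "[y']" "[]"]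
    by (intro linear_compose_add) simp_all
  show "((\<lambda>s. hderiv g [y s, v] (c s)) has_vector_derivative
      hderiv g [c1 t, y t, v] (c t) + hderiv g [y', v] (c t)) (at t)" for v
    by (rule hderiv1_along_has_vector_derivative[OF assms(1,2)])
qed

context
  fixes \<gamma>
  assumes \<gamma>: "smooth_on J \<gamma>" "\<And>t. t \<in> J \<Longrightarrow> \<gamma> t = g (c t)"
begin

lemma curve_first_derivative:
  assumes "t \<in> J"
  shows "hderiv \<gamma> [1] t = hderiv g [c1 t] (c t)"
proof (rule vector_derivative_unique_at)
  show "(\<gamma> has_vector_derivative hderiv \<gamma> [1] t) (at t)"
    using smooth_curve_has_vector_derivative[OF \<gamma>(1) assms, of "[]"] by simp
  show "(\<gamma> has_vector_derivative hderiv g [c1 t] (c t)) (at t)"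
    by (rule has_vector_derivative_transform_within_open[OF _ J assms])
       (use hderiv_has_vector_derivative_along[OF g c(2)[OF assms] c(1)[OF assms], of "[]"] \<gamma>(2) in auto)
qed

context
  fixes c2
  assumes c2: "\<And>t. t \<in> J \<Longrightarrow> (c1 has_vector_derivative c2 t) (at t)"
begin

lemma curve_second_derivative:
  assumes "t \<in> J"
  shows "hderiv \<gamma> [1, 1] t = hderiv g [c1 t, c1 t] (c t) + hderiv g [c2 t] (c t)"
proof (rule vector_derivative_unique_at[OF smooth_curve_has_vector_derivative[OF \<gamma>(1) assms]])
  show "(hderiv \<gamma> [1] has_vector_derivative hderiv g [c1 t, c1 t] (c t) + hderiv g [c2 t] (c t)) (at t)"
    by (rule has_vector_derivative_transform_within_open[OF
          hderiv1_along_has_vector_derivative[OF assms c2[OF assms]] J assms])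
       (simp add: curve_first_derivative)
qed

text \<open>The factor 3 collects the terms in \<open>c1\<close> and \<open>c2\<close>: two come
  from the slots of \<open>hderiv g [c1 s, c1 s]\<close>, one from moving the base point in
  \<open>hderiv g [c2 s]\<close>; symmetry of the second derivative identifies them.\<close>

lemma curve_third_derivative:
  assumes "t \<in> J" "(c2 has_vector_derivative c3) (at t)"
  shows "hderiv \<gamma> [1, 1, 1] t =
    hderiv g [c1 t, c1 t, c1 t] (c t) + 3 *\<^sub>R hderiv g [c2 t, c1 t] (c t) + hderiv g [c3] (c t)"
proof -
  have "((\<lambda>s. hderiv g [c1 s, c1 s] (c s) + hderiv g [c2 s] (c s)) has_vector_derivative
      (hderiv g [c1 t, c1 t, c1 t] (c t) + hderiv g [c2 t, c1 t] (c t) + hderiv g [c1 t, c2 t] (c t)) +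
      (hderiv g [c1 t, c2 t] (c t) + hderiv g [c3] (c t))) (at t)"
    by (intro has_vector_derivative_add hderiv2_along_has_vector_derivative
        hderiv1_along_has_vector_derivative assms c2)
  then have "(hderiv \<gamma> [1, 1] has_vector_derivative
      (hderiv g [c1 t, c1 t, c1 t] (c t) + hderiv g [c2 t, c1 t] (c t) + hderiv g [c1 t, c2 t] (c t)) +
      (hderiv g [c1 t, c2 t] (c t) + hderiv g [c3] (c t))) (at t)"
    by (rule has_vector_derivative_transform_within_open[OF _ J assms(1)])
       (simp add: curve_second_derivative)
  from vector_derivative_unique_at[OF smooth_curve_has_vector_derivative[OF \<gamma>(1) assms(1)] this]
  show ?thesis
    using hderiv_commute[OF V g c(1)[OF assms(1)], of "c1 t" "c2 t"]
      scaleR_left_distrib[of 1 2 "hderiv g [c2 t, c1 t] (c t)"] by (simp add: scaleR_2 add.assoc)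
qed

end

end

end

section \<open>Lifting a curve through a chart\<close>

lemma local_paramD:
  assumes "local_param M V g"
  shows "open V" "smooth_on V g" "g ` V \<subseteq> M" "openin (top_of_set M) (g ` V)" "inj_on g V"
    "continuous_on (g ` V) (inv_into V g)" "u \<in> V \<Longrightarrow> inj (\<lambda>v. hderiv g [v] u)"
  using assms by (auto simp: local_param_def hderiv.simps(2))

text \<open>Differentiating \<open>g \<circ> c = \<gamma>\<close> gives, at each order, a linear equation for the next derivative of \<open>c\<close>
  with the injective coefficient \<open>Dg\<close>; solving it avoids the inverse function theorem.\<close>
lemma curve_lift_jet:
  fixes g :: "'a::euclidean_space \<Rightarrow> 'b::euclidean_space" and \<gamma> :: "real \<Rightarrow> 'b"
  assumes lp: "local_param M V g" and "v0 \<in> V" "g v0 = \<gamma> t0"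
    and \<gamma>: "smooth_on I \<gamma>" "open I" "\<gamma> ` I \<subseteq> M" "t0 \<in> I"
  obtains c1 c2 c3 where
    "hderiv \<gamma> [1] t0 = hderiv g [c1] v0"
    "hderiv \<gamma> [1, 1] t0 = hderiv g [c1, c1] v0 + hderiv g [c2] v0"
    "hderiv \<gamma> [1, 1, 1] t0 =
       hderiv g [c1, c1, c1] v0 + 3 *\<^sub>R hderiv g [c2, c1] v0 + hderiv g [c3] v0"
proof -
  note g = local_paramD[OF lp]
  \<comment> \<open>The parameters at which the curve runs inside the image of the chart. This set
    is open because that image is open in \<open>M\<close>.\<close>
  define J where "J = I \<inter> \<gamma> -` (g ` V)"
  have contI: "continuous_on I \<gamma>"
    using smooth_curve_has_vector_derivative[OF \<gamma>(1), of _ "[]"] has_vector_derivative_continuous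
    by (fastforce intro!: continuous_at_imp_continuous_on)
  have "openin (top_of_set I) J"
    unfolding J_def by (rule continuous_openin_preimage[OF contI _ g(4)]) (use \<gamma>(3) in auto)
  then have J: "open J"
    using \<gamma>(2) openin_open_trans by blast
  have t0: "t0 \<in> J" using \<gamma>(4) assms(3) imageI[OF assms(2), of g] by (simp add: J_def)
  have \<gamma>J: "smooth_on J \<gamma>" using \<gamma>(1) by (auto simp: smooth_on_def J_def)
  define c where "c t = inv_into V g (\<gamma> t)" for t
  have cV: "c t \<in> V" and gc: "g (c t) = \<gamma> t" if "t \<in> J" for t
    using that unfolding c_def J_def by (auto intro: inv_into_into f_inv_into_f)
  have c0: "c t0 = v0"
    unfolding c_def using g(5) assms(2,3) by (metis inv_into_f_f)
  have "continuous_on J c"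
    unfolding c_def
    by (rule continuous_on_compose2[OF g(6) continuous_on_subset[OF contI]]) (auto simp: J_def)
  then have contc: "isCont c t" if "t \<in> J" for t
    using that J continuous_on_eq_continuous_at by blast
  have "\<exists>c'. (c has_vector_derivative c') (at t)" if t: "t \<in> J" for t
  proof -
    have "((\<lambda>s. g (c s)) has_vector_derivative hderiv \<gamma> [1] t) (at t)"
      by (rule has_vector_derivative_transform_within_open[OF _ J t, of \<gamma>])
         (use smooth_curve_has_vector_derivative[OF \<gamma>J t, of "[]"] gc in auto)
    with hderiv_has_derivative[OF g(2) cV[OF t], of "[]"] g(7)[OF cV[OF t]] contc[OF t]
    show ?thesis by (metis hderiv.simps(1) has_vector_derivative_lift)
  qed
  then obtain c1 where c1: "\<And>t. t \<in> J \<Longrightarrow> (c has_vector_derivative c1 t) (at t)"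
    by metis
  note along = hderiv2_along_has_vector_derivative[OF g(1,2) J cV c1]
  have solve: "\<exists>y'. (y has_vector_derivative y') (at t)"
    if t: "t \<in> J" and y: "((\<lambda>s. hderiv g [y s] (c s)) has_vector_derivative z') (at t)" for y z' t
  proof -
    have "linear (\<lambda>v. hderiv g [v] (c s))" if "s \<in> J" for s
      using linear_hderiv[OF g(1,2) cV[OF that], of "[]" "[]"] by simp
    from has_vector_derivative_linear_solution[OF J t this g(7)[OF cV[OF t]]
        hderiv_has_vector_derivative_along[OF g(2) c1[OF t] cV[OF t]] y]
    show ?thesis by blast
  qed
  note d1 = curve_first_derivative[OF g(1,2) J cV c1 \<gamma>J gc[symmetric]]
  have "\<exists>c'. (c1 has_vector_derivative c') (at t)" if t: "t \<in> J" for t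
    by (rule solve[OF t], rule has_vector_derivative_transform_within_open[OF
          smooth_curve_has_vector_derivative[OF \<gamma>J t, of "[1]"] J t]) (simp add: d1)
  then obtain c2 where c2: "\<And>t. t \<in> J \<Longrightarrow> (c1 has_vector_derivative c2 t) (at t)"
    by metis
  note d2 = curve_second_derivative[OF g(1,2) J cV c1 \<gamma>J gc[symmetric] c2]
  \<comment> \<open>The second-order identity is solved for the term
    \<open>hderiv g [c2 s] (c s)\<close>. The remaining terms are differentiable at
    \<open>t0\<close>, which gives a derivative of \<open>c2\<close> at that single point.\<close>
  have "((\<lambda>s. hderiv \<gamma> [1, 1] s - hderiv g [c1 s, c1 s] (c s)) has_vector_derivative
      hderiv \<gamma> [1, 1, 1] t0 - (hderiv g [c1 t0, c1 t0, c1 t0] (c t0) + hderiv g [c2 t0, c1 t0] (c t0) +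
        hderiv g [c1 t0, c2 t0] (c t0))) (at t0)"
    by (intro has_vector_derivative_diff smooth_curve_has_vector_derivative[OF \<gamma>J] along t0 c2)
  then have "((\<lambda>s. hderiv g [c2 s] (c s)) has_vector_derivative
      hderiv \<gamma> [1, 1, 1] t0 - (hderiv g [c1 t0, c1 t0, c1 t0] (c t0) + hderiv g [c2 t0, c1 t0] (c t0) +
        hderiv g [c1 t0, c2 t0] (c t0))) (at t0)"
    by (rule has_vector_derivative_transform_within_open[OF _ J t0]) (simp add: d2)
  from solve[OF t0 this] obtain c3 where c3: "(c2 has_vector_derivative c3) (at t0)" by blast
  note d3 = curve_third_derivative[OF g(1,2) J cV c1 \<gamma>J gc[symmetric] c2 t0 c3]
  show thesis
    by (rule that) (use d1 d2 d3 c0 t0 in simp_all)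
qed

section \<open>Smoothness of polynomial curves in a chart\<close>

text \<open>A class of curves that contains \<open>g \<circ> P\<close> and is closed under differentiation,
  which reduces smoothness of \<open>g \<circ> P\<close> to first order.\<close>
inductive_set polynomial_span :: "('a::euclidean_space \<Rightarrow> 'b::euclidean_space) \<Rightarrow> (real \<Rightarrow> 'a) \<Rightarrow> (real \<Rightarrow> 'b) set"
  for g P where
  zero: "(\<lambda>t. 0) \<in> polynomial_span g P"
| add: "F \<in> polynomial_span g P \<Longrightarrow> G \<in> polynomial_span g P \<Longrightarrow> (\<lambda>t. F t + G t) \<in> polynomial_span g P"
| base: "polynomial_function q \<Longrightarrow> (\<lambda>t. q t *\<^sub>R hderiv g vs (P t)) \<in> polynomial_span g P"

lemma polynomial_span_sum:
  assumes "finite A" "\<And>a. a \<in> A \<Longrightarrow> F a \<in> polynomial_span g P"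
  shows "(\<lambda>t. \<Sum>a\<in>A. F a t) \<in> polynomial_span g P"
  using assms by (induction A) (auto intro: polynomial_span.intros)

lemma polynomial_span_scaleR:
  assumes "F \<in> polynomial_span g P"
  shows "(\<lambda>t. r *\<^sub>R F t) \<in> polynomial_span g P"
  using assms
proof induction
  case zero
  show ?case using polynomial_span.zero by simp
next
  case (add F G)
  then show ?case using polynomial_span.add by (simp add: scaleR_add_right)
next
  case (base q vs)
  have "polynomial_function (\<lambda>t. r * q t)"
    using polynomial_function_cmul[OF base, of r] by simp
  from polynomial_span.base[OF this, of g vs P] show ?case by simp
qed

text \<open>The chain rule produces the moving direction \<open>P' t\<close>. Expanding it in the
  basis turns it into fixed directions with polynomial coefficients, which is again of the
  generating form.\<close>

lemma polynomial_span_derivative: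
  assumes "open U" "smooth_on U g" "polynomial_function P" "F \<in> polynomial_span g P"
  shows "\<exists>F'\<in>polynomial_span g P. \<forall>t. P t \<in> U \<longrightarrow> (F has_vector_derivative F' t) (at t)"
  using assms(4)
proof induction
  case zero
  show ?case by (intro bexI[OF _ polynomial_span.zero]) auto
next
  case (add F G)
  then obtain F' G' where "F' \<in> polynomial_span g P" "G' \<in> polynomial_span g P"
    "\<forall>t. P t \<in> U \<longrightarrow> (F has_vector_derivative F' t) (at t)"
    "\<forall>t. P t \<in> U \<longrightarrow> (G has_vector_derivative G' t) (at t)" by blast
  then show ?case
    by (intro bexI[OF _ polynomial_span.add[of F' g P G']]) (auto intro: has_vector_derivative_add)
next
  case (base q vs)
  obtain q' where q': "polynomial_function q'" "\<And>t. (q has_vector_derivative q' t) (at t)"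
    using has_vector_derivative_polynomial_function[OF base] by blast
  obtain P' where P': "polynomial_function P'" "\<And>t. (P has_vector_derivative P' t) (at t)"
    using has_vector_derivative_polynomial_function[OF assms(3)] by blast
  let ?F' = "\<lambda>t. (\<Sum>b\<in>Basis. (q t * (P' t \<bullet> b)) *\<^sub>R hderiv g (b # vs) (P t)) + q' t *\<^sub>R hderiv g vs (P t)"
  have "polynomial_function (\<lambda>t. q t * (P' t \<bullet> b))" for b
    using polynomial_function_mult[OF base polynomial_function_inner[OF P'(1)], of b] by simp
  then have F': "?F' \<in> polynomial_span g P"
    by (intro polynomial_span.add polynomial_span_sum polynomial_span.base q'(1)) auto
  have "((\<lambda>t. q t *\<^sub>R hderiv g vs (P t)) has_vector_derivative ?F' t) (at t)" if "P t \<in> U" for t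
  proof -
    have lin: "linear (\<lambda>v. hderiv g (v # vs) (P t))"
      using linear_hderiv[OF assms(1,2) that, of "[]" vs] by simp
    have "hderiv g (P' t # vs) (P t) = (\<Sum>b\<in>Basis. (P' t \<bullet> b) *\<^sub>R hderiv g (b # vs) (P t))"
      by (rule linear_Basis_expansion[OF lin])
    then have e: "q t *\<^sub>R hderiv g (P' t # vs) (P t) + q' t *\<^sub>R hderiv g vs (P t) = ?F' t"
      by (simp add: scaleR_sum_right)
    show ?thesis
      using has_vector_derivative_scaleR[OF
          q'(2)[folded has_real_derivative_iff_has_vector_derivative]
          hderiv_has_vector_derivative_along[OF assms(2) P'(2) that, of vs]]
      unfolding e .
  qed
  then show ?case by (intro bexI[OF _ F']) simp
qed

text \<open>By induction on the list of directions, each iterated derivative agrees on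
  \<open>I\<close> with a member of \<open>polynomial_span g P\<close>, and every member is
  differentiable wherever \<open>P\<close> stays in \<open>U\<close>.\<close>

lemma smooth_on_compose_polynomial:
  fixes g :: "'a::euclidean_space \<Rightarrow> 'b::euclidean_space" and P :: "real \<Rightarrow> 'a"
  assumes "open U" "smooth_on U g" "polynomial_function P" "open I" "P ` I \<subseteq> U"
  shows "smooth_on I (\<lambda>t. g (P t))"
proof -
  have step: "(hderiv (\<lambda>t. g (P t)) vs has_derivative (\<lambda>r. r *\<^sub>R F' t)) (at t)"
    if "t \<in> I" and eq: "\<And>t. t \<in> I \<Longrightarrow> hderiv (\<lambda>t. g (P t)) vs t = F t"
      and F': "\<forall>t. P t \<in> U \<longrightarrow> (F has_vector_derivative F' t) (at t)" for vs F' t and F :: "real \<Rightarrow> 'b"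
  proof -
    have "(F has_derivative (\<lambda>r. r *\<^sub>R F' t)) (at t)"
      using F' that(1) assms(5) unfolding has_vector_derivative_def by blast
    then show ?thesis
      by (rule has_derivative_transform_within_open[OF _ assms(4) that(1)]) (simp add: eq)
  qed
  have span: "\<exists>F\<in>polynomial_span g P. \<forall>t\<in>I. hderiv (\<lambda>t. g (P t)) vs t = F t" for vs
  proof (induction vs)
    case Nil
    have "(\<lambda>t. 1 *\<^sub>R hderiv g [] (P t)) \<in> polynomial_span g P"
      by (rule polynomial_span.base) simp
    then show ?case by (intro bexI) auto
  next
    case (Cons v vs)
    then obtain F where F: "F \<in> polynomial_span g P" "\<And>t. t \<in> I \<Longrightarrow> hderiv (\<lambda>t. g (P t)) vs t = F t"
      by blast
    from polynomial_span_derivative[OF assms(1-3) F(1)] obtain F' where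
      F': "F' \<in> polynomial_span g P" "\<forall>t. P t \<in> U \<longrightarrow> (F has_vector_derivative F' t) (at t)" by blast
    have "hderiv (\<lambda>t. g (P t)) (v # vs) t = v *\<^sub>R F' t" if "t \<in> I" for t
      using frechet_derivative_at[OF step[OF that F(2) F'(2)], symmetric]
      by (simp add: hderiv.simps(2))
    then show ?case by (intro bexI[OF _ polynomial_span_scaleR[OF F'(1), of v]]) simp
  qed
  show ?thesis
    unfolding smooth_on_def
  proof (intro allI ballI)
    fix vs t assume t: "t \<in> I"
    obtain F where F: "F \<in> polynomial_span g P" "\<And>t. t \<in> I \<Longrightarrow> hderiv (\<lambda>t. g (P t)) vs t = F t"
      using span by blast
    from polynomial_span_derivative[OF assms(1-3) F(1)] step[OF t F(2)]
    show "hderiv (\<lambda>t. g (P t)) vs differentiable at t"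
      unfolding differentiable_def by blast
  qed
qed

text \<open>The curve is \<open>f\<close> composed with a cubic polynomial whose derivatives at 0
  are \<open>v\<close>, \<open>w\<close> and \<open>z\<close>. It must stay in the chart and be
  regular on all of the unit interval, so the parameter is slowed by a factor
  \<open>\<epsilon>\<close>, and the k-th derivative is scaled by the k-th power of
  \<open>\<epsilon>\<close>.\<close>

lemma exists_curve_with_jet:
  fixes f :: "'a::euclidean_space \<Rightarrow> 'b::euclidean_space"
  assumes lp: "local_param M U f" and u: "u \<in> U" and v: "v \<noteq> 0"
  obtains \<gamma> :: "real \<Rightarrow> 'b" and \<epsilon> :: real where "\<epsilon> > 0" "smooth_on {0<..<1} \<gamma>" "\<gamma> ` {0<..<1} \<subseteq> M"
    "\<forall>t\<in>{0<..<1}. hderiv \<gamma> [1] t \<noteq> 0" "\<gamma> (1 / 2) = f u"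
    "hderiv \<gamma> [1] (1 / 2) = \<epsilon> *\<^sub>R hderiv f [v] u"
    "hderiv \<gamma> [1, 1] (1 / 2) = \<epsilon>\<^sup>2 *\<^sub>R (hderiv f [v, v] u + hderiv f [w] u)"
    "hderiv \<gamma> [1, 1, 1] (1 / 2) =
       \<epsilon> ^ 3 *\<^sub>R (hderiv f [v, v, v] u + 3 *\<^sub>R hderiv f [w, v] u + hderiv f [z] u)"
proof -
  note f = local_paramD[OF lp]
  define Q where "Q \<tau> = u + \<tau> *\<^sub>R v + (\<tau>\<^sup>2 / 2) *\<^sub>R w + (\<tau> ^ 3 / 6) *\<^sub>R z" for \<tau> :: real
  define Q1 where "Q1 \<tau> = v + \<tau> *\<^sub>R w + (\<tau>\<^sup>2 / 2) *\<^sub>R z" for \<tau> :: real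
  define Q2 where "Q2 \<tau> = w + \<tau> *\<^sub>R z" for \<tau> :: real
  have Q: "(Q has_vector_derivative Q1 \<tau>) (at \<tau>)" for \<tau>
    unfolding Q_def[abs_def] Q1_def by (auto intro!: derivative_eq_intros)
  have Q1: "(Q1 has_vector_derivative Q2 \<tau>) (at \<tau>)" for \<tau>
    unfolding Q1_def[abs_def] Q2_def by (auto intro!: derivative_eq_intros)
  have Q2: "(Q2 has_vector_derivative z) (at \<tau>)" for \<tau>
    unfolding Q2_def[abs_def] by (auto intro!: derivative_eq_intros)
  have "\<forall>\<^sub>F \<tau> in nhds 0. Q \<tau> \<in> U"
  proof (rule topological_tendstoD[OF _ f(1)])
    show "(Q \<longlongrightarrow> u) (nhds 0)"
      using has_vector_derivative_continuous[OF Q[of 0]]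
      unfolding continuous_at tendsto_at_iff_tendsto_nhds by (simp add: Q_def)
  qed (rule u)
  moreover have "\<forall>\<^sub>F \<tau> in nhds 0. Q1 \<tau> \<in> - {0}"
  proof (rule topological_tendstoD)
    show "(Q1 \<longlongrightarrow> v) (nhds 0)"
      using has_vector_derivative_continuous[OF Q1[of 0]]
      unfolding continuous_at tendsto_at_iff_tendsto_nhds by (simp add: Q1_def)
  qed (use v in auto)
  ultimately have "\<forall>\<^sub>F \<tau> in nhds 0. Q \<tau> \<in> U \<and> Q1 \<tau> \<noteq> 0"
    by eventually_elim auto
  then obtain \<epsilon> where \<epsilon>: "\<epsilon> > 0" "\<And>\<tau>. \<bar>\<tau>\<bar> < \<epsilon> \<Longrightarrow> Q \<tau> \<in> U \<and> Q1 \<tau> \<noteq> 0"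
    unfolding eventually_nhds_metric dist_real_def by auto
  \<comment> \<open>Sends the unit interval into the range where \<open>Q\<close> stays in
    \<open>U\<close> and \<open>Q1\<close> does not vanish, with the midpoint going to 0.\<close>
  define r where "r t = \<epsilon> * (t - 1 / 2)" for t
  have r: "(r has_vector_derivative \<epsilon>) (at t)" for t
    unfolding r_def[abs_def] has_real_derivative_iff_has_vector_derivative[symmetric]
    by (auto intro!: derivative_eq_intros)
  have small: "\<bar>r t\<bar> < \<epsilon>" if "t \<in> {0<..<1}" for t
  proof -
    have "\<bar>t - 1 / 2\<bar> < 1" using that by (auto simp: abs_if)
    then show ?thesis using \<epsilon>(1) by (simp add: r_def abs_mult)
  qed
  have chain: "((\<lambda>t. k *\<^sub>R h (r t)) has_vector_derivative (k * \<epsilon>) *\<^sub>R h') (at t)"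
    if "(h has_vector_derivative h') (at (r t))" for k t and h :: "real \<Rightarrow> 'a" and h'
    using bounded_linear.has_vector_derivative[OF bounded_linear_scaleR_right vector_diff_chain_at[OF r that], of k]
    by (simp add: o_def)
  define P where "P t = Q (r t)" for t
  define \<gamma> where "\<gamma> t = f (P t)" for t
  have pr: "polynomial_function r"
    unfolding r_def[abs_def] real_polynomial_function_eq[symmetric]
    by (intro real_polynomial_function.intros real_polynomial_function_diff) (simp_all add: real_polynomial_function_eq)
  have "polynomial_function (\<lambda>\<tau>::real. \<tau> ^ n / k)" for n k
    unfolding real_polynomial_function_eq[symmetric]
    by (intro real_polynomial_function_divide real_polynomial_function_power) (simp add: real_polynomial_function_eq)
  then have "polynomial_function Q"
    unfolding Q_def[abs_def]
    by (intro polynomial_function_add polynomial_function_mult polynomial_function_const polynomial_function_id)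
  from polynomial_function_compose[OF pr this] have P: "polynomial_function P"
    by (simp add: P_def[abs_def] o_def)
  let ?J = "{0<..<1::real}"
  have PU: "P t \<in> U" if "t \<in> ?J" for t
    using \<epsilon>(2)[OF small[OF that]] by (simp add: P_def)
  then have \<gamma>: "smooth_on ?J \<gamma>"
    unfolding \<gamma>_def[abs_def] by (intro smooth_on_compose_polynomial[OF f(1,2) P]) auto
  have P1: "(P has_vector_derivative \<epsilon> *\<^sub>R Q1 (r t)) (at t)" for t
    using chain[OF Q, of 1] by (simp add: P_def[abs_def])
  have P2: "((\<lambda>t. \<epsilon> *\<^sub>R Q1 (r t)) has_vector_derivative \<epsilon>\<^sup>2 *\<^sub>R Q2 (r t)) (at t)" for t
    using chain[OF Q1, of \<epsilon>] by (simp add: power2_eq_square)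
  have P3: "((\<lambda>t. \<epsilon>\<^sup>2 *\<^sub>R Q2 (r t)) has_vector_derivative \<epsilon> ^ 3 *\<^sub>R z) (at t)" for t
    using chain[OF Q2, of "\<epsilon>\<^sup>2"] by (simp add: power2_eq_square power3_eq_cube)
  have half: "1 / 2 \<in> ?J" by simp
  have at_half: "r (1 / 2) = 0" "P (1 / 2) = u" "Q1 0 = v" "Q2 0 = w"
    by (simp_all add: r_def P_def Q_def Q1_def Q2_def)
  have lin: "hderiv f (us @ (k *\<^sub>R x) # vs) u = k *\<^sub>R hderiv f (us @ x # vs) u" for us vs k x
    by (rule linear_cmul[OF linear_hderiv[OF f(1,2) u]])
  note cmul = lin[of "[]", simplified] lin[of "[x]" for x, simplified] lin[of "[x, y]" for x y, simplified]
  have d1: "hderiv \<gamma> [1] t = hderiv f [\<epsilon> *\<^sub>R Q1 (r t)] (P t)" if "t \<in> ?J" for t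
    using curve_first_derivative[OF f(1,2) _ _ P1 \<gamma>, of t] PU that by (simp add: \<gamma>_def)
  have d2: "hderiv \<gamma> [1, 1] t = hderiv f [\<epsilon> *\<^sub>R Q1 (r t), \<epsilon> *\<^sub>R Q1 (r t)] (P t) +
      hderiv f [\<epsilon>\<^sup>2 *\<^sub>R Q2 (r t)] (P t)" if "t \<in> ?J" for t
    using curve_second_derivative[OF f(1,2) _ _ P1 \<gamma> _ P2, of t] PU that by (simp add: \<gamma>_def)
  have d3: "hderiv \<gamma> [1, 1, 1] t =
      hderiv f [\<epsilon> *\<^sub>R Q1 (r t), \<epsilon> *\<^sub>R Q1 (r t), \<epsilon> *\<^sub>R Q1 (r t)] (P t) +
      3 *\<^sub>R hderiv f [\<epsilon>\<^sup>2 *\<^sub>R Q2 (r t), \<epsilon> *\<^sub>R Q1 (r t)] (P t) + hderiv f [\<epsilon> ^ 3 *\<^sub>R z] (P t)"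
    if "t \<in> ?J" for t
    using curve_third_derivative[OF f(1,2) _ _ P1 \<gamma> _ P2 _ P3, of t] PU that by (simp add: \<gamma>_def)
  show thesis
  proof (rule that)
    show "\<epsilon> > 0" by (rule \<epsilon>)
    show "smooth_on ?J \<gamma>" by (rule \<gamma>)
    show "\<gamma> ` ?J \<subseteq> M" using PU f(3) by (auto simp: \<gamma>_def)
    show "\<forall>t\<in>?J. hderiv \<gamma> [1] t \<noteq> 0"
    proof
      fix t assume t: "t \<in> ?J"
      have lin0: "linear (\<lambda>x. hderiv f [x] (P t))"
        using linear_hderiv[OF f(1,2) PU[OF t], of "[]" "[]"] by simp
      have "\<epsilon> *\<^sub>R Q1 (r t) \<noteq> 0" using \<epsilon>(1) \<epsilon>(2)[OF small[OF t]] by simp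
      then show "hderiv \<gamma> [1] t \<noteq> 0"
        unfolding d1[OF t] using linear_injective_0[OF lin0] f(7)[OF PU[OF t]] by blast
    qed
    show "\<gamma> (1 / 2) = f u" by (simp add: \<gamma>_def at_half)
    show "hderiv \<gamma> [1] (1 / 2) = \<epsilon> *\<^sub>R hderiv f [v] u"
      using d1[OF half] by (simp add: at_half cmul)
    show "hderiv \<gamma> [1, 1] (1 / 2) = \<epsilon>\<^sup>2 *\<^sub>R (hderiv f [v, v] u + hderiv f [w] u)"
      using d2[OF half] by (simp add: at_half cmul power2_eq_square scaleR_add_right)
    show "hderiv \<gamma> [1, 1, 1] (1 / 2) =
       \<epsilon> ^ 3 *\<^sub>R (hderiv f [v, v, v] u + 3 *\<^sub>R hderiv f [w, v] u + hderiv f [z] u)"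
      using d3[OF half] by (simp add: at_half cmul power2_eq_square power3_eq_cube scaleR_add_right mult_ac)
  qed
qed

section \<open>Independence of the chart\<close>

lemma local_param_linear:
  fixes f :: "'a::euclidean_space \<Rightarrow> 'b::euclidean_space"
  assumes "local_param M U f" "u \<in> U"
  shows "linear (\<lambda>x. hderiv f [x] u)" "linear (\<lambda>x. hderiv f [x, y] u)" "linear (\<lambda>y. hderiv f [x, y] u)"
  using linear_hderiv[OF local_paramD(1,2)[OF assms(1)] assms(2), of "[]" "[]"]
    linear_hderiv[OF local_paramD(1,2)[OF assms(1)] assms(2), of "[]" "[y]"]
    linear_hderiv[OF local_paramD(1,2)[OF assms(1)] assms(2), of "[x]" "[]"]
  by simp_all

text \<open>The same curve in \<open>M\<close> is read in both charts and its velocity and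
  acceleration are compared; the acceleration of the lifted curve contributes only a tangential
  term. The case \<open>a = 0\<close> is separate because the curve construction requires a nonzero
  velocity.\<close>

lemma change_of_chart_jet:
  fixes f g :: "'a::euclidean_space \<Rightarrow> 'b::euclidean_space"
  assumes f: "local_param M U f" "u \<in> U" and g: "local_param M V g" "v \<in> V" and "f u = g v"
  obtains b where "hderiv g [b] v = hderiv f [a] u"
    "hderiv f [a, a] u - hderiv g [b, b] v \<in> range (\<lambda>c. hderiv g [c] v)"
proof (cases "a = 0")
  case True
  note zero = linear_0[OF local_param_linear(1)[OF f]] linear_0[OF local_param_linear(1)[OF g]]
    linear_0[OF local_param_linear(2)[OF f]] linear_0[OF local_param_linear(2)[OF g]]
  show thesis
    by (rule that[of 0]) (use rangeI[of "\<lambda>c. hderiv g [c] v" 0] in \<open>simp_all add: True zero\<close>)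
next
  case False
  \<comment> \<open>The second and third coefficients are 0: the curve is a straight line in the
    chart \<open>f\<close>, so its acceleration is a multiple of
    \<open>hderiv f [a, a] u\<close>.\<close>
  obtain \<gamma> :: "real \<Rightarrow> 'b" and \<epsilon> :: real where \<gamma>: "\<epsilon> > 0" "smooth_on {0<..<1} \<gamma>" "\<gamma> ` {0<..<1} \<subseteq> M" "\<gamma> (1 / 2) = f u"
    "hderiv \<gamma> [1] (1 / 2) = \<epsilon> *\<^sub>R hderiv f [a] u"
    "hderiv \<gamma> [1, 1] (1 / 2) = \<epsilon>\<^sup>2 *\<^sub>R (hderiv f [a, a] u + hderiv f [0] u)"
    by (rule exists_curve_with_jet[OF f False, of 0 0]) blast
  have "g v = \<gamma> (1 / 2)" using \<gamma>(4) assms(5) by simp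
  then obtain c1 c2 where "hderiv \<gamma> [1] (1 / 2) = hderiv g [c1] v"
    "hderiv \<gamma> [1, 1] (1 / 2) = hderiv g [c1, c1] v + hderiv g [c2] v"
    by (rule curve_lift_jet[OF g _ \<gamma>(2) _ \<gamma>(3)]) auto
  then have c: "\<epsilon> *\<^sub>R hderiv f [a] u = hderiv g [c1] v"
    "\<epsilon>\<^sup>2 *\<^sub>R hderiv f [a, a] u = hderiv g [c1, c1] v + hderiv g [c2] v"
    using \<gamma>(5,6) linear_0[OF local_param_linear(1)[OF f]] by simp_all
  let ?b = "inverse \<epsilon> *\<^sub>R c1"
  show thesis
  proof (rule that[of ?b])
    show "hderiv g [?b] v = hderiv f [a] u"
      using \<gamma>(1) by (simp add: linear_cmul[OF local_param_linear(1)[OF g]] c(1)[symmetric])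
    have "hderiv f [a, a] u = (inverse \<epsilon>)\<^sup>2 *\<^sub>R (\<epsilon>\<^sup>2 *\<^sub>R hderiv f [a, a] u)"
      using \<gamma>(1) by (simp add: power_inverse)
    also have "\<dots> = (inverse \<epsilon>)\<^sup>2 *\<^sub>R (hderiv g [c1, c1] v + hderiv g [c2] v)"
      by (simp only: c(2))
    also have "\<dots> = hderiv g [?b, ?b] v + hderiv g [(inverse \<epsilon>)\<^sup>2 *\<^sub>R c2] v"
      by (simp add: linear_cmul[OF local_param_linear(1)[OF g]] linear_cmul[OF local_param_linear(2)[OF g]]
          linear_cmul[OF local_param_linear(3)[OF g]] scaleR_add_right power2_eq_square)
    finally show "hderiv f [a, a] u - hderiv g [?b, ?b] v \<in> range (\<lambda>c. hderiv g [c] v)"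
      by simp
  qed
qed

lemma range_hderiv_chart_eq:
  fixes f g :: "'a::euclidean_space \<Rightarrow> 'b::euclidean_space"
  assumes "local_param M U f" "u \<in> U" "local_param M V g" "v \<in> V" "f u = g v"
  shows "range (\<lambda>a. hderiv f [a] u) = range (\<lambda>a. hderiv g [a] v)"
proof -
  have "hderiv f [a] u \<in> range (\<lambda>a. hderiv g [a] v)" for a
    by (rule change_of_chart_jet[OF assms, of a]) (metis rangeI)
  moreover have "hderiv g [a] v \<in> range (\<lambda>a. hderiv f [a] u)" for a
    by (rule change_of_chart_jet[OF assms(3,4,1,2) assms(5)[symmetric], of a]) (metis rangeI)
  ultimately show ?thesis by blast
qed

text \<open>Nonsingularity of the second fundamental form read in a chart: the normal part of a
  vector vanishes exactly when the vector is tangent, so no orthogonal projection appears.\<close>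

definition hessian_nonsingular :: "('a::euclidean_space \<Rightarrow> 'b::euclidean_space) \<Rightarrow> 'a \<Rightarrow> bool" where
  "hessian_nonsingular f u \<longleftrightarrow>
     (\<forall>a b. hderiv f [a, b] u \<in> range (\<lambda>c. hderiv f [c] u) \<longrightarrow> a = 0 \<or> b = 0)"

text \<open>The map \<open>\<phi>\<close> plays the role of the derivative of the transition map.
  Injectivity of the first derivatives makes it additive with trivial kernel. The two Hessians agree
  on the diagonal modulo tangent vectors, hence everywhere by polarization.\<close>

lemma hessian_nonsingular_change_of_chart:
  fixes f g :: "'a::euclidean_space \<Rightarrow> 'b::euclidean_space"
  assumes f: "local_param M U f" "u \<in> U" and g: "local_param M V g" "v \<in> V" and fg: "f u = g v"
    and ns: "hessian_nonsingular g v"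
  shows "hessian_nonsingular f u"
proof -
  let ?T = "range (\<lambda>c. hderiv g [c] v)"
  have sub: "subspace ?T"
    by (rule linear_subspace_image[OF local_param_linear(1)[OF g] subspace_UNIV])
  have "\<exists>b. hderiv g [b] v = hderiv f [a] u \<and> hderiv f [a, a] u - hderiv g [b, b] v \<in> ?T" for a
    by (rule change_of_chart_jet[OF f g fg, of a]) blast
  then obtain \<phi> where \<phi>: "\<And>a. hderiv g [\<phi> a] v = hderiv f [a] u"
      "\<And>a. hderiv f [a, a] u - hderiv g [\<phi> a, \<phi> a] v \<in> ?T"
    by metis
  have add: "\<phi> (a + b) = \<phi> a + \<phi> b" for a b
    by (rule injD[OF local_paramD(7)[OF g]])
       (simp add: \<phi>(1) linear_add[OF local_param_linear(1)[OF f]] linear_add[OF local_param_linear(1)[OF g]])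
  have zero: "a = 0" if "\<phi> a = 0" for a
    by (rule injD[OF local_paramD(7)[OF f]])
       (use \<phi>(1)[of a] that linear_0[OF local_param_linear(1)[OF f]] linear_0[OF local_param_linear(1)[OF g]] in simp)
  have "hderiv f [a, b] u - hderiv g [\<phi> a, \<phi> b] v \<in> ?T" for a b
  proof -
    \<comment> \<open>Polarization: bilinearity and symmetry leave twice the mixed
      difference.\<close>
    have "(hderiv f [a + b, a + b] u - hderiv g [\<phi> (a + b), \<phi> (a + b)] v)
        - (hderiv f [a, a] u - hderiv g [\<phi> a, \<phi> a] v) - (hderiv f [b, b] u - hderiv g [\<phi> b, \<phi> b] v) \<in> ?T"
      by (intro subspace_diff[OF sub] \<phi>(2))
    also have "(hderiv f [a + b, a + b] u - hderiv g [\<phi> (a + b), \<phi> (a + b)] v)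
        - (hderiv f [a, a] u - hderiv g [\<phi> a, \<phi> a] v) - (hderiv f [b, b] u - hderiv g [\<phi> b, \<phi> b] v)
        = 2 *\<^sub>R (hderiv f [a, b] u - hderiv g [\<phi> a, \<phi> b] v)"
      using hderiv_commute[OF local_paramD(1,2)[OF f(1)] f(2), of b a]
        hderiv_commute[OF local_paramD(1,2)[OF g(1)] g(2), of "\<phi> b" "\<phi> a"]
      by (simp add: add linear_add[OF local_param_linear(2)[OF f]] linear_add[OF local_param_linear(3)[OF f]]
          linear_add[OF local_param_linear(2)[OF g]] linear_add[OF local_param_linear(3)[OF g]] scaleR_2)
    finally have "(1 / 2) *\<^sub>R 2 *\<^sub>R (hderiv f [a, b] u - hderiv g [\<phi> a, \<phi> b] v) \<in> ?T"
      by (rule subspace_scale[OF sub])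
    then show ?thesis by simp
  qed
  note diff = this
  show ?thesis
    unfolding hessian_nonsingular_def
  proof (intro allI impI)
    fix a b assume "hderiv f [a, b] u \<in> range (\<lambda>c. hderiv f [c] u)"
    then have "hderiv f [a, b] u \<in> ?T"
      using range_hderiv_chart_eq[OF f g fg] by simp
    from subspace_diff[OF sub this diff[of a b]] have "hderiv g [\<phi> a, \<phi> b] v \<in> ?T"
      by simp
    then show "a = 0 \<or> b = 0"
      using ns zero unfolding hessian_nonsingular_def by blast
  qed
qed

section \<open>The second fundamental form in a chart\<close>

lemma normal_proj_eq_0_iff:
  fixes T :: "'b::euclidean_space set"
  assumes "subspace T"
  shows "normal_proj T v = 0 \<longleftrightarrow> v \<in> T"
proof -
  obtain y z where yz: "y \<in> T" "\<And>w. w \<in> T \<Longrightarrow> orthogonal z w" "v = y + z"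
    using orthogonal_subspace_decomp_exists[of T v] span_eq_iff[of T] assms by metis
  have unique: "w = z" if w: "(\<forall>t\<in>T. w \<bullet> t = 0) \<and> v - w \<in> T" for w
  proof -
    have "(v - w) - y \<in> T" using subspace_diff[OF assms] w yz(1) by blast
    then have T: "z - w \<in> T" by (simp add: yz(3))
    then have "(z - w) \<bullet> (z - w) = 0"
      using w yz(2)[OF T] by (simp add: orthogonal_def inner_diff_left)
    then show ?thesis by simp
  qed
  have "normal_proj T v = z"
    unfolding normal_proj_def
    by (rule the_equality) (use yz unique in \<open>auto simp: orthogonal_def\<close>)
  moreover have "z = 0 \<longleftrightarrow> v \<in> T"
    using yz(1,3) unique[of 0] by auto
  ultimately show ?thesis by simp
qed

text \<open>For the chart selected by \<open>chart_at\<close>, injectivity of the first derivative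
  makes the chosen preimages of tangent vectors unique, so the form is the normal part of the
  Hessian. The passage to \<open>g\<close> is the change of chart.\<close>

lemma second_fundamental_form_nonsingular_iff:
  fixes g :: "'a::euclidean_space \<Rightarrow> 'b::euclidean_space"
  assumes g: "local_param M V g" "v \<in> V" and p: "g v = p"
  shows "(\<forall>x\<in>tangent_space M TYPE('a) p. \<forall>y\<in>tangent_space M TYPE('a) p.
           second_fundamental_form M TYPE('a) p x y = 0 \<longrightarrow> x = 0 \<or> y = 0) \<longleftrightarrow> hessian_nonsingular g v"
proof -
  obtain h u where chart: "chart_at M TYPE('a) p = (h, u)"
    by (cases "chart_at M TYPE('a) p")
  \<comment> \<open>The given chart \<open>g\<close> shows that the choice in
    \<open>chart_at\<close> has a witness.\<close>
  have "case chart_at M TYPE('a) p of (f, u) \<Rightarrow> \<exists>U. local_param M U f \<and> u \<in> U \<and> f u = p"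
    unfolding chart_at_def by (rule someI[of _ "(g, v)"]) (use g p in auto)
  then obtain U where h: "local_param M U h" "u \<in> U" "h u = p"
    using chart by auto
  have frechet: "frechet_derivative h (at u) = (\<lambda>a. hderiv h [a] u)"
    by (simp add: hderiv.simps(2))
  have inj: "hderiv h [a] u = hderiv h [b] u \<longleftrightarrow> a = b" for a b
    using local_paramD(7)[OF h(1,2)] by (auto dest: injD)
  have T: "tangent_space M TYPE('a) p = range (\<lambda>a. hderiv h [a] u)"
    by (simp add: tangent_space_def chart frechet)
  have sub: "subspace (range (\<lambda>a. hderiv h [a] u))"
    by (rule linear_subspace_image[OF local_param_linear(1)[OF h(1,2)] subspace_UNIV])
  have II: "second_fundamental_form M TYPE('a) p (hderiv h [a] u) (hderiv h [b] u) =
      normal_proj (range (\<lambda>a. hderiv h [a] u)) (hderiv h [a, b] u)" for a b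
    by (simp add: second_fundamental_form_def chart frechet T inj)
  have zero: "hderiv h [a] u = 0 \<longleftrightarrow> a = 0" for a
    using inj[of a 0] linear_0[OF local_param_linear(1)[OF h(1,2)]] by simp
  have "(\<forall>x\<in>tangent_space M TYPE('a) p. \<forall>y\<in>tangent_space M TYPE('a) p.
           second_fundamental_form M TYPE('a) p x y = 0 \<longrightarrow> x = 0 \<or> y = 0) \<longleftrightarrow> hessian_nonsingular h u"
    unfolding T hessian_nonsingular_def by (simp add: II normal_proj_eq_0_iff[OF sub] zero)
  also have "\<dots> \<longleftrightarrow> hessian_nonsingular g v"
    using hessian_nonsingular_change_of_chart[OF h(1,2) g] hessian_nonsingular_change_of_chart[OF g h(1,2)]
      h(3) p by auto
  finally show ?thesis .
qed

section \<open>The local condition in terms of curves\<close>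

lemma local_condition_iff_hessian_and_curves:
  fixes g :: "'a::euclidean_space \<Rightarrow> 'b::euclidean_space"
  assumes g: "local_param M V g" "v \<in> V" and p: "g v = p"
  shows "local_condition g v \<longleftrightarrow> hessian_nonsingular g v \<and>
    (\<forall>(\<gamma>::real \<Rightarrow> 'b) t0.
       smooth_on {0<..<1} \<gamma> \<and> \<gamma> ` {0<..<1} \<subseteq> M \<and> (\<forall>t\<in>{0<..<1}. hderiv \<gamma> [1] t \<noteq> 0) \<and>
       t0 \<in> {0<..<1} \<and> \<gamma> t0 = p \<longrightarrow> hderiv \<gamma> [1, 1, 1] t0 \<noteq> 0)"
    (is "_ \<longleftrightarrow> _ \<and> ?curves")
proof (intro iffI conjI)
  note lin = local_param_linear[OF g]
  assume lc: "local_condition g v"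
  have lcD: "v1 = 0 \<and> v2 = 0 \<and> k = 0"
    if "v3 \<noteq> 0" "hderiv g [v1] v + hderiv g [v2, v3] v + k *\<^sub>R hderiv g [v3, v3, v3] v = 0" for v1 v2 v3 k
    using lc that unfolding local_condition_def by blast
  show "hessian_nonsingular g v"
    unfolding hessian_nonsingular_def
  proof (intro allI impI)
    fix a b assume "hderiv g [a, b] v \<in> range (\<lambda>c. hderiv g [c] v)"
    then obtain c where "hderiv g [a, b] v = hderiv g [c] v" by auto
    \<comment> \<open>A tangential value of the Hessian is a solution with scalar 0.\<close>
    then have "hderiv g [- c] v + hderiv g [a, b] v + 0 *\<^sub>R hderiv g [b, b, b] v = 0"
      by (simp add: linear_neg[OF lin(1)])
    then show "a = 0 \<or> b = 0" using lcD by blast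
  qed
  show ?curves
  proof (intro allI impI notI)
    fix \<gamma> :: "real \<Rightarrow> 'b" and t0
    assume \<gamma>: "smooth_on {0<..<1} \<gamma> \<and> \<gamma> ` {0<..<1} \<subseteq> M \<and> (\<forall>t\<in>{0<..<1}. hderiv \<gamma> [1] t \<noteq> 0) \<and>
       t0 \<in> {0<..<1} \<and> \<gamma> t0 = p" and 0: "hderiv \<gamma> [1, 1, 1] t0 = 0"
    obtain c1 c2 c3 where c: "hderiv \<gamma> [1] t0 = hderiv g [c1] v"
      "hderiv \<gamma> [1, 1, 1] t0 = hderiv g [c1, c1, c1] v + 3 *\<^sub>R hderiv g [c2, c1] v + hderiv g [c3] v"
      by (rule curve_lift_jet[OF g, of \<gamma> t0 "{0<..<1}"]) (use \<gamma> p in auto)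
    have "c1 \<noteq> 0" using c(1) \<gamma> linear_0[OF lin(1)] by auto
    \<comment> \<open>A vanishing third derivative is a solution with scalar 1, the factor 3 being
      moved into the second vector.\<close>
    moreover have "hderiv g [c3] v + hderiv g [3 *\<^sub>R c2, c1] v + 1 *\<^sub>R hderiv g [c1, c1, c1] v = 0"
      using c(2) 0 by (simp add: linear_cmul[OF lin(2)] ac_simps)
    ultimately show False using lcD by (metis zero_neq_one)
  qed
next
  note lin = local_param_linear[OF g]
  assume *: "hessian_nonsingular g v \<and> ?curves"
  show "local_condition g v"
    unfolding local_condition_def
  proof (intro allI impI)
    fix v1 v2 v3 and k :: real
    assume A: "v3 \<noteq> 0 \<and> hderiv g [v1] v + hderiv g [v2, v3] v + k *\<^sub>R hderiv g [v3, v3, v3] v = 0"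
    have "k = 0"
    proof (rule ccontr)
      assume k: "k \<noteq> 0"
      \<comment> \<open>The coefficients are chosen so that the third derivative is the left-hand
        side of the equation divided by \<open>k\<close>, up to a power of
        \<open>\<epsilon>\<close>.\<close>
      obtain \<gamma> :: "real \<Rightarrow> 'b" and \<epsilon> :: real where \<gamma>: "smooth_on {0<..<1} \<gamma>" "\<gamma> ` {0<..<1} \<subseteq> M"
        "\<forall>t\<in>{0<..<1}. hderiv \<gamma> [1] t \<noteq> 0" "\<gamma> (1 / 2) = g v"
        "hderiv \<gamma> [1, 1, 1] (1 / 2) = \<epsilon> ^ 3 *\<^sub>R (hderiv g [v3, v3, v3] v +
           3 *\<^sub>R hderiv g [inverse (3 * k) *\<^sub>R v2, v3] v + hderiv g [inverse k *\<^sub>R v1] v)"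
        using A by (elim conjE exists_curve_with_jet[OF g, of v3 "inverse (3 * k) *\<^sub>R v2" "inverse k *\<^sub>R v1"]) blast
      have "hderiv g [v3, v3, v3] v + 3 *\<^sub>R hderiv g [inverse (3 * k) *\<^sub>R v2, v3] v + hderiv g [inverse k *\<^sub>R v1] v
          = inverse k *\<^sub>R (hderiv g [v1] v + hderiv g [v2, v3] v + k *\<^sub>R hderiv g [v3, v3, v3] v)"
        using k by (simp add: linear_cmul[OF lin(1)] linear_cmul[OF lin(2)] scaleR_add_right)
      then have "hderiv \<gamma> [1, 1, 1] (1 / 2) = 0" using A \<gamma>(5) by simp
      moreover have "hderiv \<gamma> [1, 1, 1] (1 / 2) \<noteq> 0"
        by (rule conjunct2[OF *, rule_format], intro conjI \<gamma>(1-3)) (simp_all add: \<gamma>(4) p)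
      ultimately show False by blast
    qed
    \<comment> \<open>With scalar 0 the Hessian value is tangent, so \<open>v2\<close> vanishes
      because \<open>v3\<close> does not; injectivity of the first derivative then removes
      \<open>v1\<close>.\<close>
    with A have "hderiv g [v2, v3] v = hderiv g [- v1] v"
      by (simp add: linear_neg[OF lin(1)] eq_neg_iff_add_eq_0 add.commute)
    then have v2: "v2 = 0" using * A unfolding hessian_nonsingular_def by blast
    with A \<open>k = 0\<close> have "hderiv g [v1] v = hderiv g [0] v"
      by (simp add: linear_0[OF lin(1)] linear_0[OF lin(2)])
    with v2 \<open>k = 0\<close> show "v1 = 0 \<and> v2 = 0 \<and> k = 0"
      using local_paramD(7)[OF g] by (auto dest: injD)
  qed
qed

theorem theorem4p1:
  fixes M :: "'b::euclidean_space set" and U :: "'a::euclidean_space set"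
    and f :: "'a \<Rightarrow> 'b" and u0 :: 'a and p :: 'b
  assumes "smooth_submanifold M TYPE('a)"
    and "local_param M U f" and "u0 \<in> U" and "f u0 = p"
  shows "(local_condition f u0 \<longleftrightarrow>
            (\<forall>x\<in>tangent_space M TYPE('a) p. \<forall>y\<in>tangent_space M TYPE('a) p.
                second_fundamental_form M TYPE('a) p x y = 0 \<longrightarrow> x = 0 \<or> y = 0) \<and>
            (\<forall>(\<gamma>::real \<Rightarrow> 'b) t0.
                smooth_on {0<..<1} \<gamma> \<and> \<gamma> ` {0<..<1} \<subseteq> M \<and>
                (\<forall>t\<in>{0<..<1}. hderiv \<gamma> [1] t \<noteq> 0) \<and>
                t0 \<in> {0<..<1} \<and> \<gamma> t0 = p
                \<longrightarrow> hderiv \<gamma> [1, 1, 1] t0 \<noteq> 0))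
         \<and> (\<forall>V (g::'a \<Rightarrow> 'b) v0. local_param M V g \<and> v0 \<in> V \<and> g v0 = p
                \<longrightarrow> (local_condition g v0 \<longleftrightarrow> local_condition f u0))"
proof -
  \<comment> \<open>Proved for an arbitrary chart through \<open>p\<close>: the right-hand side does
    not mention the chart, so both the equivalence for \<open>f\<close> and the independence of the
    chart follow.\<close>
  have "local_condition g v0 \<longleftrightarrow>
            (\<forall>x\<in>tangent_space M TYPE('a) p. \<forall>y\<in>tangent_space M TYPE('a) p.
                second_fundamental_form M TYPE('a) p x y = 0 \<longrightarrow> x = 0 \<or> y = 0) \<and>
            (\<forall>(\<gamma>::real \<Rightarrow> 'b) t0.
                smooth_on {0<..<1} \<gamma> \<and> \<gamma> ` {0<..<1} \<subseteq> M \<and>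
                (\<forall>t\<in>{0<..<1}. hderiv \<gamma> [1] t \<noteq> 0) \<and>
                t0 \<in> {0<..<1} \<and> \<gamma> t0 = p
                \<longrightarrow> hderiv \<gamma> [1, 1, 1] t0 \<noteq> 0)"
    if "local_param M V g" "v0 \<in> V" "g v0 = p" for V v0 and g :: "'a \<Rightarrow> 'b"
    unfolding second_fundamental_form_nonsingular_iff[OF that]
    by (rule local_condition_iff_hessian_and_curves[OF that])
  note char = this
  show ?thesis
    by (intro conjI[OF char[OF assms(2-4)]] allI impI) (elim conjE, rule trans[OF char char[OF assms(2-4), symmetric]])
qed

end
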